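(* Let $\varphi$ be a random variable with probability distribution supported in $[0,1)$ (that is, $\varphi\in[0,1)$ almost surely), and let $u_k=\mathbb{E}[\varphi^k]$ for $k\ge 0$ (so $u_0=1$). Let $(X_t)_{t\in\mathbb{Z}}$ be a long-memory process with Wold decomposition $$X_t=\sum_{k=0}^{\infty}u_k\,\epsilon_{t-k},$$ where the $u_k$ are nonnegative and $\sum_{k=0}^{\infty}u_k=\infty$. Then the coefficients $a_k$ of the equivalent infinite autoregressive representation $$X_t=\sum_{k=1}^{\infty}a_kX_{t-k}+\epsilon_t,$$ which are defined by $a_1=u_1$ and $a_{k+1}=u_{k+1}-\sum_{r=1}^{k}a_r u_{k-r+1}$ for $k\ge 1$, satisfy $$\sum_{k=1}^{\infty}a_k=1.$$
   Context: Here $(\epsilon_t)_{t\in\mathbb{Z}}$ is a white noise process with mean zero and variance $\sigma_\epsilon^2$, and the series defining $X_t$ is understood in $\mathcal{L}^2$. A (second-order stationary) process is said to have long memory if its autocovariance function is not summable. The sum $\sum_{k\ge1} a_k$ is understood as the limit of partial sums (its convergence is part of the assertion). *)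

theory Defs
  imports "HOL-Probability.Probability"
begin

definition square_integrable :: "'a measure \<Rightarrow> ('a \<Rightarrow> real) \<Rightarrow> bool" where
  "square_integrable N Y \<longleftrightarrow>
     Y \<in> borel_measurable N \<and> integrable N (\<lambda>\<omega>. (Y \<omega>)\<^sup>2)"

definition covariance :: "'a measure \<Rightarrow> ('a \<Rightarrow> real) \<Rightarrow> ('a \<Rightarrow> real) \<Rightarrow> real" where
  "covariance N Y Z =
     (\<integral>\<omega>. (Y \<omega> - (\<integral>\<omega>'. Y \<omega>' \<partial>N)) * (Z \<omega> - (\<integral>\<omega>'. Z \<omega>' \<partial>N)) \<partial>N)"

definition white_noise :: "'a measure \<Rightarrow> (int \<Rightarrow> 'a \<Rightarrow> real) \<Rightarrow> real \<Rightarrow> bool" where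
  "white_noise N \<epsilon> v \<longleftrightarrow>
     (\<forall>t. square_integrable N (\<epsilon> t)) \<and>
     (\<forall>t. (\<integral>\<omega>. \<epsilon> t \<omega> \<partial>N) = 0) \<and>
     (\<forall>t. covariance N (\<epsilon> t) (\<epsilon> t) = v) \<and>
     (\<forall>s t. s \<noteq> t \<longrightarrow> covariance N (\<epsilon> s) (\<epsilon> t) = 0)"

definition second_order_stationary :: "'a measure \<Rightarrow> (int \<Rightarrow> 'a \<Rightarrow> real) \<Rightarrow> bool" where
  "second_order_stationary N X \<longleftrightarrow>
     (\<forall>t. square_integrable N (X t)) \<and>
     (\<forall>s t. (\<integral>\<omega>. X s \<omega> \<partial>N) = (\<integral>\<omega>. X t \<omega> \<partial>N)) \<and>
     (\<forall>s t h. covariance N (X (s + h)) (X s) = covariance N (X (t + h)) (X t))"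

(* Evaluated at the reference time 0, which under stationarity is no restriction. *)
definition autocovariance :: "'a measure \<Rightarrow> (int \<Rightarrow> 'a \<Rightarrow> real) \<Rightarrow> int \<Rightarrow> real" where
  "autocovariance N X h = covariance N (X h) (X 0)"

(* For real-valued functions, summability over an index set in the sense of
   summable_on is absolute summability. *)
definition long_memory :: "'a measure \<Rightarrow> (int \<Rightarrow> 'a \<Rightarrow> real) \<Rightarrow> bool" where
  "long_memory N X \<longleftrightarrow>
     second_order_stationary N X \<and> \<not> autocovariance N X summable_on UNIV"

(* Convergence of the partial sums in L2(N). Square integrability of the terms and of
   the limit is required explicitly, because the Bochner integral of a non-integrable
   function is 0. *)
definition L2_sums :: "'a measure \<Rightarrow> (nat \<Rightarrow> 'a \<Rightarrow> real) \<Rightarrow> ('a \<Rightarrow> real) \<Rightarrow> bool" where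
  "L2_sums N f Y \<longleftrightarrow>
     (\<forall>k. square_integrable N (f k)) \<and> square_integrable N Y \<and>
     (\<lambda>n. \<integral>\<omega>. (Y \<omega> - (\<Sum>k<n. f k \<omega>))\<^sup>2 \<partial>N) \<longlonglongrightarrow> 0"

end

theory Submission
  imports Defs
begin

text \<open>
  Being a moment sequence, \<open>u\<close> is nonincreasing and log-convex, and divergence of its
  sum forces it to be positive. By Kaluza's argument log-convexity makes the \<open>a k\<close>
  nonnegative. The renewal equation \<open>u n = (\<Sum>r=1..n. a r * u (n - r))\<close> then gives
  \<open>u n \<ge> (\<Sum>r=1..n. a r) * u n\<close> by monotonicity of \<open>u\<close>, so the \<open>a k\<close> sum to some
  \<open>A \<le> 1\<close>. Summing the renewal equation, the partial sums \<open>S\<close> of \<open>u\<close> satisfy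
  \<open>S n \<le> 1 + A * S n\<close>; since they are unbounded, \<open>A < 1\<close> is impossible.
\<close>

lemma log_convex_quotient_mono:
  fixes u :: "nat \<Rightarrow> real"
  assumes pos: "\<And>k. u k > 0"
    and convex: "\<And>k. (u (Suc k))\<^sup>2 \<le> u k * u (Suc (Suc k))"
    and "j \<le> k"
  shows "u (Suc j) / u j \<le> u (Suc k) / u k"
proof (rule lift_Suc_mono_le[OF _ \<open>j \<le> k\<close>])
  show "u (Suc n) / u n \<le> u (Suc (Suc n)) / u (Suc n)" for n
    using convex[of n] pos[of n] pos[of "Suc n"]
    by (simp add: divide_simps power2_eq_square mult.commute)
qed

text \<open>Kaluza's comparison: in the equation for \<open>u (Suc n)\<close>, the terms with
  \<open>r < n\<close> are bounded by \<open>q\<close> times the terms of the equation for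
  \<open>u n\<close>, which sum to \<open>q * u n = u (Suc n)\<close>. What remains,
  \<open>c n * u 0\<close>, is therefore nonnegative. The index of \<open>c\<close> is shifted by
  one, so \<open>c r\<close> stands for \<open>a (r + 1)\<close>.\<close>

lemma renewal_nonneg:
  fixes u c :: "nat \<Rightarrow> real"
  assumes u0: "u 0 = 1" and pos: "\<And>k. u k > 0"
    and convex: "\<And>k. (u (Suc k))\<^sup>2 \<le> u k * u (Suc (Suc k))"
    and renewal: "\<And>n. u (Suc n) = (\<Sum>r\<le>n. c r * u (n - r))"
  shows "c n \<ge> 0"
proof (induction n rule: less_induct)
  case (less n)
  show ?case
  proof (cases n)
    case 0
    then show ?thesis using renewal[of 0] pos[of 1] u0 by simp
  next
    case (Suc m)
    \<comment> \<open>Quotients of consecutive terms are nondecreasing, so \<open>q\<close> bounds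
      every earlier one.\<close>
    define q where "q = u (Suc n) / u n"
    have "(\<Sum>r\<le>m. c r * u (n - r)) \<le> (\<Sum>r\<le>m. q * (c r * u (m - r)))"
    proof (rule sum_mono)
      fix r assume "r \<in> {..m}"
      then have r: "r < n" "n - r = Suc (m - r)" using Suc by auto
      have "u (Suc (m - r)) / u (m - r) \<le> q"
        unfolding q_def by (rule log_convex_quotient_mono[of u, OF pos convex]) (use Suc in simp)
      then have "u (n - r) \<le> q * u (m - r)"
        using pos[of "m - r"] r by (simp add: divide_simps mult.commute)
      then have "c r * u (n - r) \<le> c r * (q * u (m - r))"
        by (rule mult_left_mono) (use less r in simp)
      then show "c r * u (n - r) \<le> q * (c r * u (m - r))"
        by (simp add: ac_simps)
    qed
    also have "\<dots> = q * u n"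
      using renewal[of m] Suc by (simp add: sum_distrib_left)
    also have "\<dots> = u (Suc n)"
      using pos[of n] by (simp add: q_def)
    finally show ?thesis
      using renewal[of n] u0 Suc by simp
  qed
qed

lemma renewal_partial_sums:
  fixes u c :: "nat \<Rightarrow> real"
  assumes u0: "u 0 = 1" and renewal: "\<And>n. u (Suc n) = (\<Sum>r\<le>n. c r * u (n - r))"
  shows "(\<Sum>k\<le>Suc n. u k) = 1 + (\<Sum>r\<le>n. c r * (\<Sum>k\<le>n - r. u k))"
proof (induction n)
  case 0
  then show ?case using renewal[of 0] u0 by simp
next
  case (Suc n)
  \<comment> \<open>Each inner sum gains one term; together with the new outer term
    \<open>c (Suc n) * u 0\<close> these gains are the renewal equation for
    \<open>u (Suc (Suc n))\<close>.\<close>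
  have "(\<Sum>r\<le>n. c r * (\<Sum>k\<le>Suc n - r. u k))
      = (\<Sum>r\<le>n. c r * (\<Sum>k\<le>n - r. u k) + c r * u (Suc n - r))"
    by (rule sum.cong) (simp_all add: Suc_diff_le distrib_left)
  then show ?case
    using Suc renewal[of "Suc n"] by (simp add: sum.distrib)
qed

lemma renewal_sums_1:
  fixes u c :: "nat \<Rightarrow> real"
  assumes u0: "u 0 = 1" and nonneg: "\<And>k. u k \<ge> 0" and decr: "decseq u"
    and convex: "\<And>k. (u (Suc k))\<^sup>2 \<le> u k * u (Suc (Suc k))"
    and diverges: "filterlim (\<lambda>n. \<Sum>k<n. u k) at_top sequentially"
    and renewal: "\<And>n. u (Suc n) = (\<Sum>r\<le>n. c r * u (n - r))"
  shows "c sums 1"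
proof -
  \<comment> \<open>The upper limit \<open>Suc n\<close> matches the left side of
    \<open>renewal_partial_sums\<close>.\<close>
  have unbounded: "\<exists>n. (\<Sum>k\<le>Suc n. u k) > B" for B
  proof -
    have "eventually (\<lambda>n. (\<Sum>k<n. u k) > B) sequentially"
      using diverges by (simp add: filterlim_at_top_dense)
    then obtain n where "(\<Sum>k<n. u k) > B"
      by (auto simp: eventually_sequentially)
    also have "(\<Sum>k<n. u k) \<le> (\<Sum>k\<le>Suc n. u k)"
      by (rule sum_mono2) (auto simp: nonneg)
    finally show ?thesis by blast
  qed
  \<comment> \<open>A zero would persist by monotonicity, leaving only finitely many nonzero terms
    and bounded partial sums.\<close>
  have pos: "u k > 0" for k
  proof (rule ccontr)
    assume "\<not> u k > 0"
    then have zero: "u m = 0" if "m \<ge> k" for m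
      using nonneg[of m] nonneg[of k] decseqD[OF decr that] by simp
    obtain n where "(\<Sum>k\<le>Suc n. u k) > (\<Sum>j<k. u j)"
      using unbounded by blast
    moreover have "(\<Sum>j\<le>Suc n. u j) = (\<Sum>j\<in>{..Suc n} \<inter> {..<k}. u j)"
      by (rule sum.mono_neutral_right) (auto intro: zero leI)
    moreover have "\<dots> \<le> (\<Sum>j<k. u j)"
      by (rule sum_mono2) (auto simp: nonneg)
    ultimately show False by simp
  qed
  have c_nonneg: "c n \<ge> 0" for n
    by (rule renewal_nonneg[OF u0 pos convex renewal])
  have le1: "(\<Sum>r\<le>n. c r) \<le> 1" for n
  proof -
    have "(\<Sum>r\<le>n. c r) * u (Suc n) = (\<Sum>r\<le>n. c r * u (Suc n))"
      by (simp add: sum_distrib_right)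
    also have "\<dots> \<le> (\<Sum>r\<le>n. c r * u (n - r))"
      by (intro sum_mono mult_left_mono c_nonneg decseqD[OF decr]) auto
    also have "\<dots> = u (Suc n)" by (rule renewal[symmetric])
    finally show ?thesis using pos[of "Suc n"] by simp
  qed
  have partial: "(\<Sum>r<n. c r) \<le> 1" for n
    using le1[of n] c_nonneg[of n] by (simp add: lessThan_Suc_atMost[symmetric])
  have summable: "summable c"
    by (rule summableI_nonneg_bounded[OF c_nonneg partial])
  have suminf_le: "suminf c \<le> 1"
    by (rule suminf_le_const[OF summable partial])
  have bound: "(\<Sum>k\<le>Suc n. u k) * (1 - suminf c) \<le> 1" for n
  proof -
    have "(\<Sum>k\<le>Suc n. u k) = 1 + (\<Sum>r\<le>n. c r * (\<Sum>k\<le>n - r. u k))"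
      by (rule renewal_partial_sums[OF u0 renewal])
    \<comment> \<open>Extending all inner sums to the same range makes them a common factor.\<close>
    also have "\<dots> \<le> 1 + (\<Sum>r\<le>n. c r * (\<Sum>k\<le>Suc n. u k))"
      by (intro add_left_mono sum_mono mult_left_mono c_nonneg sum_mono2) (auto simp: nonneg)
    also have "\<dots> = 1 + (\<Sum>r\<le>n. c r) * (\<Sum>k\<le>Suc n. u k)"
      by (simp only: sum_distrib_right)
    also have "\<dots> \<le> 1 + suminf c * (\<Sum>k\<le>Suc n. u k)"
      by (intro add_left_mono mult_right_mono sum_le_suminf summable sum_nonneg)
        (auto simp: nonneg c_nonneg)
    finally show ?thesis by (simp add: algebra_simps)
  qed
  have "suminf c = 1"
  proof (rule ccontr)
    assume "suminf c \<noteq> 1"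
    with suminf_le have lt: "1 - suminf c > 0" by simp
    obtain n where "(\<Sum>k\<le>Suc n. u k) > 1 / (1 - suminf c)"
      using unbounded by blast
    with bound[of n] lt show False by (simp add: pos_divide_less_eq)
  qed
  with summable show ?thesis by (simp add: sums_iff)
qed

context prob_space
begin

lemma integrable_power_unit:
  fixes \<phi> :: "'a \<Rightarrow> real"
  assumes "\<phi> \<in> borel_measurable M" and "AE \<omega> in M. \<phi> \<omega> \<in> {0..1}"
  shows "integrable M (\<lambda>\<omega>. \<phi> \<omega> ^ k)"
proof (rule integrable_const_bound[where B = 1])
  show "AE \<omega> in M. norm (\<phi> \<omega> ^ k) \<le> 1"
    using assms(2) by eventually_elim (simp add: power_le_one)
qed (use assms(1) in measurable)

lemma moments_decseq:
  fixes \<phi> :: "'a \<Rightarrow> real"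
  assumes "\<phi> \<in> borel_measurable M" and unit: "AE \<omega> in M. \<phi> \<omega> \<in> {0..1}"
  shows "decseq (\<lambda>k. expectation (\<lambda>\<omega>. \<phi> \<omega> ^ k))"
proof (rule decseq_SucI)
  fix k
  show "expectation (\<lambda>\<omega>. \<phi> \<omega> ^ Suc k) \<le> expectation (\<lambda>\<omega>. \<phi> \<omega> ^ k)"
  proof (rule integral_mono_AE)
    show "AE \<omega> in M. \<phi> \<omega> ^ Suc k \<le> \<phi> \<omega> ^ k"
      using unit by eventually_elim (auto intro: mult_left_le_one_le)
  qed (rule integrable_power_unit[OF assms])+
qed

text \<open>This is Cauchy-Schwarz for the weight \<open>\<phi> \<omega> ^ k\<close>: the
  expectation of \<open>\<phi> \<omega> ^ k * (\<phi> \<omega> - x)\<^sup>2\<close> is a nonnegative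
  quadratic in \<open>x\<close>.\<close>

lemma moments_log_convex:
  fixes \<phi> :: "'a \<Rightarrow> real"
  assumes "\<phi> \<in> borel_measurable M" and unit: "AE \<omega> in M. \<phi> \<omega> \<in> {0..1}"
  defines "u \<equiv> \<lambda>k. expectation (\<lambda>\<omega>. \<phi> \<omega> ^ k)"
  shows "(u (Suc k))\<^sup>2 \<le> u k * u (Suc (Suc k))"
proof -
  note int = integrable_power_unit[OF assms(1,2)]
  have quadratic: "u (Suc (Suc k)) - 2 * x * u (Suc k) + x\<^sup>2 * u k \<ge> 0" for x
  proof -
    have "0 \<le> expectation (\<lambda>\<omega>. \<phi> \<omega> ^ k * (\<phi> \<omega> - x)\<^sup>2)"
      by (rule integral_nonneg_AE, use unit in eventually_elim) simp
    also have "\<dots> = expectation (\<lambda>\<omega>. \<phi> \<omega> ^ Suc (Suc k) - 2 * x * \<phi> \<omega> ^ Suc k + x\<^sup>2 * \<phi> \<omega> ^ k)"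
      by (simp add: power2_eq_square algebra_simps)
    also have "\<dots> = u (Suc (Suc k)) - 2 * x * u (Suc k) + x\<^sup>2 * u k"
      unfolding u_def using int[of k] int[of "Suc k"] int[of "Suc (Suc k)"]
      by (simp del: power_Suc)
    finally show ?thesis .
  qed
  have nonneg: "u j \<ge> 0" for j
    unfolding u_def by (rule integral_nonneg_AE, use unit in eventually_elim) simp
  show ?thesis
  proof (cases "u k = 0")
    case True
    have "u (Suc k) \<le> u k"
      using decseqD[OF moments_decseq[OF assms(1,2)], of k "Suc k"] by (simp add: u_def)
    then have "u (Suc k) = 0" using True nonneg[of "Suc k"] by simp
    then show ?thesis using True by simp
  next
    case False
    then show ?thesis
      using quadratic[of "u (Suc k) / u k"] nonneg[of k]
      by (simp add: field_simps power2_eq_square)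
  qed
qed

end

theorem theorem2:
  fixes M :: "'a measure" and \<phi> :: "'a \<Rightarrow> real"
    and N :: "'b measure" and \<epsilon> X :: "int \<Rightarrow> 'b \<Rightarrow> real" and \<sigma> :: real
    and u a :: "nat \<Rightarrow> real"
  assumes "prob_space M"
    and "\<phi> \<in> borel_measurable M"
    and "AE \<omega> in M. \<phi> \<omega> \<in> {0..<1}"
    and "\<And>k. u k = (\<integral>\<omega>. \<phi> \<omega> ^ k \<partial>M)"
    and "prob_space N"
    and "white_noise N \<epsilon> (\<sigma>\<^sup>2)"
    and "long_memory N X"
    and "\<And>t. L2_sums N (\<lambda>k \<omega>. u k * \<epsilon> (t - int k) \<omega>) (X t)"
    and "\<And>k. u k \<ge> 0"
    and "filterlim (\<lambda>n. \<Sum>k<n. u k) at_top sequentially"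
    and "a 1 = u 1"
    and "\<And>k. k \<ge> 1 \<Longrightarrow> a (k + 1) = u (k + 1) - (\<Sum>r=1..k. a r * u (k - r + 1))"
  shows "(\<lambda>k. a (k + 1)) sums 1"
proof -
  interpret M: prob_space M by fact
  have unit: "AE \<omega> in M. \<phi> \<omega> \<in> {0..1}"
    using assms(3) by eventually_elim simp
  have u_eq: "u = (\<lambda>k. M.expectation (\<lambda>\<omega>. \<phi> \<omega> ^ k))"
    using assms(4) by blast
  have u0: "u 0 = 1"
    using assms(4)[of 0] by (simp add: M.prob_space)
  \<comment> \<open>Since \<open>u 0 = 1\<close>, the coefficient \<open>a (n + 1)\<close> is the
    summand \<open>r = n\<close>. The recursion for \<open>a\<close> starts at \<open>k = 1\<close>,
    so \<open>n = 0\<close> is covered by \<open>a 1 = u 1\<close>.\<close>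
  have renewal: "u (Suc n) = (\<Sum>r\<le>n. a (r + 1) * u (n - r))" for n
  proof (cases n)
    case 0
    then show ?thesis using assms(11) u0 by simp
  next
    case (Suc m)
    have "(\<Sum>r=1..n. a r * u (n - r + 1)) = (\<Sum>r\<le>m. a (r + 1) * u (n - r))"
      unfolding Suc by (rule sum.reindex_bij_witness[of _ Suc "\<lambda>r. r - 1"])
        (auto simp: Suc_diff_le)
    then show ?thesis using assms(12)[of n] u0 Suc by simp
  qed
  show ?thesis
  proof (rule renewal_sums_1[OF u0 assms(9) _ _ assms(10) renewal])
    show "decseq u"
      unfolding u_eq by (rule M.moments_decseq[OF assms(2) unit])
    show "(u (Suc k))\<^sup>2 \<le> u k * u (Suc (Suc k))" for k
      unfolding u_eq by (rule M.moments_log_convex[OF assms(2) unit])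
  qed
qed

end
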